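(* For every $t\in\{1,\dots,T-1\}$, every point $\hat x_t\in\{0,1\}^{d_x}$ and every family of valid affine cuts $(\alpha_t^i,\beta_t^i)\in\mathbb{R}^{d_x}\times\mathbb{R}$, $i\in\mathcal{N}_{t+1}$, for the functions $Q^{RR}_{t+1}(\cdot,\omega^i_{t+1})$, i.e. $$Q^{RR}_{t+1}(x_t,\omega^i_{t+1})\ge (\alpha_t^i)^\top x_t+\beta_t^i\quad\text{for all }x_t\in\{0,1\}^{d_x},\ i\in\mathcal{N}_{t+1},$$ the function $$\phi^C_t(x_t):=\min\{\phi\in\mathbb{R}:\ \phi\ge \pi_t^\top(x_t-\hat x_t)+\gamma_t\},$$ whose coefficients are, for $j\in\{1,\dots,d_x\}$, $$\pi_{t,j}:=\begin{cases}\min_{P_{t+1}\in\mathcal{P}_{t+1}}\sum_{i\in\mathcal{N}_{t+1}}p^i_{t+1}\alpha^i_{t,j}, & \hat x_{t,j}=0,\\ \max_{P_{t+1}\in\mathcal{P}_{t+1}}\sum_{i\in\mathcal{N}_{t+1}}p^i_{t+1}\alpha^i_{t,j}, & \hat x_{t,j}=1,\end{cases}\qquad \gamma_t:=\min_{P_{t+1}\in\mathcal{P}_{t+1}}\sum_{i\in\mathcal{N}_{t+1}}p^i_{t+1}\big((\alpha^i_t)^\top\hat x_t+\beta^i_t\big),$$ provides a lower bound for the optimistic expected cost-to-go function: $$\phi^C_t(x_t)\le \mathcal{Q}^{RR}_{t+1}(x_t)\quad\text{for all }x_t\in\{0,1\}^{d_x}.$$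
   Context: Distributionally risk-receptive multistage stochastic integer program (DRR-MSIP) with $T$ stages. At stage $t$ there are binary state variables $x_t\in\{0,1\}^{d_x}$ and local variables $y_t$. For $t=2,\dots,T$ the random vector of stage $t$ has finite support $\Omega_t=\{\omega_t^i: i\in\mathcal{N}_t\}$, $\mathcal{N}_t=\{1,\dots,N_t\}$; random vectors are stage-wise independent. A probability distribution on $\Omega_t$ is identified with a vector $P_t=(p_t^i)_{i\in\mathcal{N}_t}$, $p_t^i\ge0$, $\sum_i p_t^i=1$. The ambiguity set $\mathcal{P}_t$ is a nonempty set of such vectors; minima and maxima over $\mathcal{P}_t$ are taken to exist, as the notation presupposes. The feasible sets $X_t(x_{t-1},\omega_t)$ of pairs $(x_t,y_t)$ are nonempty compact mixed-integer sets for all $x_{t-1}\in\{0,1\}^{d_x}$, $\omega_t\in\Omega_t$, and $f_t(x_t,y_t,\omega_t)$ is linear in $(x_t,y_t)$. The cost-to-go functions are defined recursively, for $t=T,\dots,2$, by $$Q_t^{RR}(x_{t-1},\omega_t)=\min_{(x_t,y_t)\in X_t(x_{t-1},\omega_t)}\Big\{f_t(x_t,y_t,\omega_t)+\mathcal{Q}^{RR}_{t+1}(x_t)\Big\},\qquad Q^{RR}_{T+1}=0,$$ where the optimistic expected cost-to-go function is $$\mathcal{Q}^{RR}_{t+1}(x_t)=\min_{P_{t+1}\in\mathcal{P}_{t+1}}\sum_{i\in\mathcal{N}_{t+1}}p_{t+1}^i\,Q^{RR}_{t+1}(x_t,\omega_{t+1}^i)$$ (and $\mathcal{Q}^{RR}_{T+1}=0$).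 *)

theory Defs
  imports "HOL-Analysis.Analysis"
begin

definition min_over :: "'a set \<Rightarrow> ('a \<Rightarrow> real) \<Rightarrow> real" where
  "min_over A g = (LEAST v. v \<in> g ` A)"

definition max_over :: "'a set \<Rightarrow> ('a \<Rightarrow> real) \<Rightarrow> real" where
  "max_over A g = (GREATEST v. v \<in> g ` A)"

definition binary_points :: "(real ^ 'd) set" where
  "binary_points = {x. \<forall>j. x $ j \<in> {0, 1}}"

definition prob_vectors :: "nat \<Rightarrow> (nat \<Rightarrow> real) set" where
  "prob_vectors n = {p \<in> {1..n} \<rightarrow>\<^sub>E {0..}. (\<Sum>i = 1..n. p i) = 1}"

text \<open>
  The data of stages \<open>2, \<dots>, T\<close>, where \<open>T = horizon M\<close>. Stage-wise independence is built in:
  scenarios and ambiguity sets depend on the stage only, not on the history.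
  The type \<open>real ^ 'm\<close> hosts the local variables of all stages; a stage with fewer local variables
  has feasible sets in which the surplus coordinates vanish. \<open>integer_coords M t\<close> are the
  integer-constrained local coordinates of stage \<open>t\<close>.
\<close>

record ('w, 'd, 'm) drr_msip =
  horizon :: nat
  num_scenarios :: "nat \<Rightarrow> nat"
  scenario :: "nat \<Rightarrow> nat \<Rightarrow> 'w"
  ambiguity :: "nat \<Rightarrow> (nat \<Rightarrow> real) set"
  integer_coords :: "nat \<Rightarrow> 'm set"
  feasible :: "nat \<Rightarrow> real ^ 'd \<Rightarrow> 'w \<Rightarrow> ((real ^ 'd) \<times> (real ^ 'm)) set"
  cost :: "nat \<Rightarrow> real ^ 'd \<Rightarrow> real ^ 'm \<Rightarrow> 'w \<Rightarrow> real"

definition scenarios :: "('w, 'd::finite, 'm::finite) drr_msip \<Rightarrow> nat \<Rightarrow> 'w set" where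
  "scenarios M t = scenario M t ` {1..num_scenarios M t}"

definition expect :: "('w, 'd::finite, 'm::finite) drr_msip \<Rightarrow> nat \<Rightarrow> (nat \<Rightarrow> real) \<Rightarrow> (nat \<Rightarrow> real) \<Rightarrow> real" where
  "expect M t c p = (\<Sum>i = 1..num_scenarios M t. p i * c i)"

text \<open>
  Minima and maxima over an ambiguity set are required for every linear objective, since the slopes
  of valid cuts can be arbitrary vectors. For the feasible sets no such requirement is needed:
  minima exist by compactness, as the first component ranges over finitely many points.
\<close>

definition valid_drr_msip :: "('w, 'd::finite, 'm::finite) drr_msip \<Rightarrow> bool" where
  "valid_drr_msip M \<longleftrightarrow>
    (\<forall>t\<in>{2..horizon M}.
      ambiguity M t \<noteq> {} \<and> ambiguity M t \<subseteq> prob_vectors (num_scenarios M t) \<and>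
      (\<forall>c. \<exists>p\<in>ambiguity M t. \<forall>q\<in>ambiguity M t. expect M t c p \<le> expect M t c q) \<and>
      (\<forall>c. \<exists>p\<in>ambiguity M t. \<forall>q\<in>ambiguity M t. expect M t c q \<le> expect M t c p) \<and>
      (\<forall>w\<in>scenarios M t.
        linear (\<lambda>(x, y). cost M t x y w) \<and>
        (\<forall>x\<in>binary_points.
          feasible M t x w \<noteq> {} \<and> compact (feasible M t x w) \<and>
          feasible M t x w \<subseteq> {(x', y'). x' \<in> binary_points \<and> (\<forall>k\<in>integer_coords M t. y' $ k \<in> \<int>)})))"

function Q_RR :: "('w, 'd::finite, 'm::finite) drr_msip \<Rightarrow> nat \<Rightarrow> real ^ 'd \<Rightarrow> 'w \<Rightarrow> real"
  and EQ_RR :: "('w, 'd::finite, 'm::finite) drr_msip \<Rightarrow> nat \<Rightarrow> real ^ 'd \<Rightarrow> real" where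
  "Q_RR M t x w =
    (if t > horizon M then 0
     else min_over (feasible M t x w) (\<lambda>(x', y'). cost M t x' y' w + EQ_RR M (Suc t) x'))"
| "EQ_RR M t x =
    (if t > horizon M then 0
     else min_over (ambiguity M t) (expect M t (\<lambda>i. Q_RR M t x (scenario M t i))))"
  by pat_completeness auto
termination
  by (relation "Wellfounded.measure (\<lambda>s. case s of
        Inl (M, t, _, _) \<Rightarrow> 2 * (Suc (horizon M) - t)
      | Inr (M, t, _) \<Rightarrow> Suc (2 * (Suc (horizon M) - t)))") auto

declare Q_RR.simps [simp del] EQ_RR.simps [simp del]

definition valid_cuts ::
    "('w, 'd::finite, 'm::finite) drr_msip \<Rightarrow> nat \<Rightarrow> (nat \<Rightarrow> real ^ 'd) \<Rightarrow> (nat \<Rightarrow> real) \<Rightarrow> bool" where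
  "valid_cuts M t \<alpha> \<beta> \<longleftrightarrow>
    (\<forall>x\<in>binary_points. \<forall>i\<in>{1..num_scenarios M (t + 1)}.
      Q_RR M (t + 1) x (scenario M (t + 1) i) \<ge> \<alpha> i \<bullet> x + \<beta> i)"

definition cut_slope ::
    "('w, 'd::finite, 'm::finite) drr_msip \<Rightarrow> nat \<Rightarrow> (nat \<Rightarrow> real ^ 'd) \<Rightarrow> real ^ 'd \<Rightarrow> real ^ 'd" where
  "cut_slope M t \<alpha> xh =
    (\<chi> j. if xh $ j = 0
          then min_over (ambiguity M (t + 1)) (expect M (t + 1) (\<lambda>i. \<alpha> i $ j))
          else max_over (ambiguity M (t + 1)) (expect M (t + 1) (\<lambda>i. \<alpha> i $ j)))"

definition cut_offset ::
    "('w, 'd::finite, 'm::finite) drr_msip \<Rightarrow> nat \<Rightarrow> (nat \<Rightarrow> real ^ 'd) \<Rightarrow> (nat \<Rightarrow> real) \<Rightarrow> real ^ 'd \<Rightarrow> real" where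
  "cut_offset M t \<alpha> \<beta> xh =
    min_over (ambiguity M (t + 1)) (expect M (t + 1) (\<lambda>i. \<alpha> i \<bullet> xh + \<beta> i))"

definition phi_C ::
    "('w, 'd::finite, 'm::finite) drr_msip \<Rightarrow> nat \<Rightarrow> (nat \<Rightarrow> real ^ 'd) \<Rightarrow> (nat \<Rightarrow> real) \<Rightarrow> real ^ 'd \<Rightarrow> real ^ 'd \<Rightarrow> real" where
  "phi_C M t \<alpha> \<beta> xh x = (LEAST \<phi>. \<phi> \<ge> cut_slope M t \<alpha> xh \<bullet> (x - xh) + cut_offset M t \<alpha> \<beta> xh)"

end

theory Submission
  imports Defs
begin

text \<open>
  Fix a binary point \<open>x\<close> and let \<open>p\<close> be a distribution that attains the optimistic expectation at
  \<open>x\<close>. The valid cuts bound the scenario costs from below, so the expectation under \<open>p\<close> is at least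
  that of the cuts, which splits into a constant term and one term per coordinate:
  \<open>E\<^sub>p[\<alpha> \<bullet> xh + \<beta>] + (\<Sum>j. E\<^sub>p[\<alpha>\<^sub>j] * (x\<^sub>j - xh\<^sub>j))\<close>.
  Each of these terms can now be minimised over the ambiguity set separately, which only
  lowers the value. This gives the offset for the first term. For coordinate \<open>j\<close>, the sign of
  \<open>x\<^sub>j - xh\<^sub>j\<close> is the same for all binary \<open>x\<close>: it is nonnegative if \<open>xh\<^sub>j = 0\<close> and nonpositive if
  \<open>xh\<^sub>j = 1\<close>. Hence the smallest expected slope in the former case and the largest one in the
  latter bound the term from below, independently of \<open>x\<close>; this is the slope of the aggregated
  cut (\<open>cut_slope_inner_le\<close>). Bounding the terms separately is what frees the cut
  from the optimal distribution \<open>p\<close>, which depends on \<open>x\<close>.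
\<close>

lemma min_over_eq:
  assumes "p \<in> A" and "\<And>q. q \<in> A \<Longrightarrow> g p \<le> g q"
  shows "min_over A g = g p"
  unfolding min_over_def by (rule Least_equality) (use assms in auto)

lemma max_over_eq:
  assumes "p \<in> A" and "\<And>q. q \<in> A \<Longrightarrow> g q \<le> g p"
  shows "max_over A g = g p"
  unfolding max_over_def by (rule Greatest_equality) (use assms in auto)

lemma min_over_attained:
  assumes "valid_drr_msip M" and "t \<in> {2..horizon M}"
  obtains p where "p \<in> ambiguity M t"
    and "min_over (ambiguity M t) (expect M t c) = expect M t c p"
proof -
  obtain p where p: "p \<in> ambiguity M t"
    and "\<forall>q\<in>ambiguity M t. expect M t c p \<le> expect M t c q"
    using assms unfolding valid_drr_msip_def by blast
  then have "min_over (ambiguity M t) (expect M t c) = expect M t c p"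
    by (intro min_over_eq) auto
  with p show thesis by (rule that)
qed

lemma min_over_le_expect:
  assumes "valid_drr_msip M" and "t \<in> {2..horizon M}" and "q \<in> ambiguity M t"
  shows "min_over (ambiguity M t) (expect M t c) \<le> expect M t c q"
proof -
  obtain p where p: "p \<in> ambiguity M t"
    and le: "\<forall>q\<in>ambiguity M t. expect M t c p \<le> expect M t c q"
    using assms unfolding valid_drr_msip_def by blast
  then have "min_over (ambiguity M t) (expect M t c) = expect M t c p"
    by (intro min_over_eq) auto
  with le assms(3) show ?thesis by simp
qed

lemma expect_le_max_over:
  assumes "valid_drr_msip M" and "t \<in> {2..horizon M}" and "q \<in> ambiguity M t"
  shows "expect M t c q \<le> max_over (ambiguity M t) (expect M t c)"
proof -
  obtain p where p: "p \<in> ambiguity M t"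
    and le: "\<forall>q\<in>ambiguity M t. expect M t c q \<le> expect M t c p"
    using assms unfolding valid_drr_msip_def by blast
  then have "max_over (ambiguity M t) (expect M t c) = expect M t c p"
    by (intro max_over_eq) auto
  with le assms(3) show ?thesis by simp
qed

lemma expect_mono:
  assumes "p \<in> prob_vectors (num_scenarios M t)"
    and "\<And>i. i \<in> {1..num_scenarios M t} \<Longrightarrow> c i \<le> d i"
  shows "expect M t c p \<le> expect M t d p"
  unfolding expect_def
proof (rule sum_mono)
  fix i assume i: "i \<in> {1..num_scenarios M t}"
  then have "p i \<ge> 0" using assms(1) by (auto simp: prob_vectors_def PiE_iff)
  then show "p i * c i \<le> p i * d i" using assms(2)[OF i] by (rule mult_left_mono[rotated])
qed

text \<open>
  Expectation commutes with affine functions, so recentring the cuts at \<open>xh\<close> separates the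
  displacement \<open>x - xh\<close> coordinate by coordinate.
\<close>

lemma expect_affine_recentred:
  fixes M :: "('w, 'd::finite, 'm::finite) drr_msip"
  shows "expect M t (\<lambda>i. \<alpha> i \<bullet> x + \<beta> i) p =
    (\<Sum>j\<in>UNIV. expect M t (\<lambda>i. \<alpha> i $ j) p * (x - xh) $ j) +
    expect M t (\<lambda>i. \<alpha> i \<bullet> xh + \<beta> i) p"
proof -
  have "(\<Sum>j\<in>UNIV. expect M t (\<lambda>i. \<alpha> i $ j) p * (x - xh) $ j) =
      (\<Sum>i = 1..num_scenarios M t. \<Sum>j\<in>UNIV. p i * \<alpha> i $ j * (x - xh) $ j)"
    unfolding expect_def sum_distrib_right by (rule sum.swap)
  also have "\<dots> = expect M t (\<lambda>i. \<alpha> i \<bullet> (x - xh)) p"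
    by (simp add: expect_def inner_vec_def sum_distrib_left mult.assoc)
  finally show ?thesis
    by (simp add: expect_def inner_diff_right sum.distrib[symmetric] algebra_simps)
qed

text \<open>
  At a binary centre, every binary point deviates upwards in the coordinates that are \<open>0\<close> and
  downwards in those that are \<open>1\<close>. Taking the minimal and the maximal expected slope respectively
  therefore underestimates each coordinate's contribution under every admissible distribution.
\<close>

lemma cut_slope_inner_le:
  fixes M :: "('w, 'd::finite, 'm::finite) drr_msip"
  assumes M: "valid_drr_msip M" and t: "t + 1 \<in> {2..horizon M}"
    and p: "p \<in> ambiguity M (t + 1)"
    and xh: "xh \<in> binary_points" and x: "x \<in> binary_points"
  shows "cut_slope M t \<alpha> xh \<bullet> (x - xh) \<le>
    (\<Sum>j\<in>UNIV. expect M (t + 1) (\<lambda>i. \<alpha> i $ j) p * (x - xh) $ j)"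
  unfolding inner_vec_def inner_real_def
proof (rule sum_mono)
  fix j
  have x01: "x $ j \<in> {0, 1}" and xh01: "xh $ j \<in> {0, 1}"
    using x xh by (auto simp: binary_points_def)
  show "cut_slope M t \<alpha> xh $ j * (x - xh) $ j \<le>
      expect M (t + 1) (\<lambda>i. \<alpha> i $ j) p * (x - xh) $ j"
  proof (cases "xh $ j = 0")
    case True
    then have "cut_slope M t \<alpha> xh $ j \<le> expect M (t + 1) (\<lambda>i. \<alpha> i $ j) p"
      using min_over_le_expect[OF M t p] by (simp add: cut_slope_def)
    moreover have "(x - xh) $ j \<ge> 0" using True x01 by auto
    ultimately show ?thesis by (rule mult_right_mono)
  next
    case False
    then have "expect M (t + 1) (\<lambda>i. \<alpha> i $ j) p \<le> cut_slope M t \<alpha> xh $ j"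
      using expect_le_max_over[OF M t p] by (simp add: cut_slope_def)
    moreover have "(x - xh) $ j \<le> 0" using False x01 xh01 by auto
    ultimately show ?thesis by (rule mult_right_mono_neg)
  qed
qed

lemma phi_C_eq:
  "phi_C M t \<alpha> \<beta> xh x = cut_slope M t \<alpha> xh \<bullet> (x - xh) + cut_offset M t \<alpha> \<beta> xh"
  unfolding phi_C_def by (rule Least_equality) auto

theorem theorem1:
  fixes M :: "('w, 'd::finite, 'm::finite) drr_msip"
    and t :: nat
    and xh :: "real ^ 'd"
    and \<alpha> :: "nat \<Rightarrow> real ^ 'd"
    and \<beta> :: "nat \<Rightarrow> real"
  assumes "valid_drr_msip M"
    and "t \<in> {1..<horizon M}"
    and "xh \<in> binary_points"
    and "valid_cuts M t \<alpha> \<beta>"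
  shows "\<forall>x\<in>binary_points. phi_C M t \<alpha> \<beta> xh x \<le> EQ_RR M (t + 1) x"
proof
  fix x :: "real ^ 'd"
  assume x: "x \<in> binary_points"
  have t: "t + 1 \<in> {2..horizon M}" using assms(2) by auto
  let ?Q = "\<lambda>i. Q_RR M (t + 1) x (scenario M (t + 1) i)"
  obtain p where p: "p \<in> ambiguity M (t + 1)"
    and opt: "min_over (ambiguity M (t + 1)) (expect M (t + 1) ?Q) = expect M (t + 1) ?Q p"
    using min_over_attained[OF assms(1) t] by blast
  have prob: "p \<in> prob_vectors (num_scenarios M (t + 1))"
    using assms(1) t p unfolding valid_drr_msip_def by blast
  have "phi_C M t \<alpha> \<beta> xh x = cut_slope M t \<alpha> xh \<bullet> (x - xh) + cut_offset M t \<alpha> \<beta> xh"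
    by (rule phi_C_eq)
  also have "\<dots> \<le> (\<Sum>j\<in>UNIV. expect M (t + 1) (\<lambda>i. \<alpha> i $ j) p * (x - xh) $ j) +
      expect M (t + 1) (\<lambda>i. \<alpha> i \<bullet> xh + \<beta> i) p"
    unfolding cut_offset_def
    by (intro add_mono cut_slope_inner_le min_over_le_expect assms(1,3) t p x)
  also have "\<dots> = expect M (t + 1) (\<lambda>i. \<alpha> i \<bullet> x + \<beta> i) p"
    by (rule expect_affine_recentred[symmetric])
  also have "\<dots> \<le> expect M (t + 1) ?Q p"
    using assms(4) x by (intro expect_mono prob) (auto simp: valid_cuts_def)
  also have "\<dots> = EQ_RR M (t + 1) x"
    using t opt by (simp add: EQ_RR.simps)
  finally show "phi_C M t \<alpha> \<beta> xh x \<le> EQ_RR M (t + 1) x" .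
qed

end
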